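(* Let $0<x_1<\cdots<x_N<1$ and, for $m>0$, let $\varphi_m(x)=\frac{1}{\pi}\frac{\sin mx}{x}$ for $x\in\mathbb{R}$. Assume that $\alpha_j(t)=-g_j(t)$ tends to $\overline{\alpha}_j=-\overline{g}_j\in\mathbb{R}$ as $t\to\infty$ for all $j=1,\dots,N$. For $j=1,\dots,N$ let $\overline{w}^d_j$ be the steady-state solution of the beam system with pointwise actuation, and let $\overline{\psi}^m_j$ be the steady-state solution of the regularized (lifted) system, both corresponding to the $j$-th input alone (as defined in the context). Then $\overline{\psi}^m_j\to\overline{w}^d_j$ in $C^1([0,1])$ as $m\to+\infty$, for every $j=1,\dots,N$.
   Context: The beam system with pointwise actuation is $$w^d_{tt}+w^d_{xxxx}=\sum_{j=1}^N\alpha_j(t)\delta(x-x_j),\quad x\in(0,1),\ t>0,$$ with $w^d(0,t)=w^d_x(1,t)=w^d_{xx}(0,t)=w^d_{xxx}(1,t)=0$ and zero initial data; $\delta(x-x_j)$ is the Dirac mass at $x_j$. The regularized system is $$\psi_{tt}+\psi_{xxxx}=-\sum_{j=1}^N\ddot g_j(t)H^m_j(x)-\sum_{j=1}^N g_j(t)H^m_{jxxxx}(x),\quad x\in(0,1),\ t>0,$$ with $\psi(0,t)=\psi_x(1,t)=\psi_{xx}(0,t)=\psi_{xxx}(1,t)=0$ and zero initial data, where $H^m_j$ on $[0,1]$ satisfies $H^m_{jxxxx}(x)=\varphi_m(x-x_j)$, $H^m_j(0)=H^m_{jx}(1)=H^m_{jxx}(0)=0$, $H^m_{jxxx}(1)=1$.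 Standing assumption: $g_j\in C^3([0,+\infty))$ and $g_j(0)=\dot g_j(0)=0$. The steady-state solutions corresponding to the $j$-th input are the time-independent functions on $[0,1]$ solving, respectively, $$\overline{w}^d_{jxxxx}(x)=\overline{\alpha}_j\delta(x-x_j)\ \text{ (in the sense of distributions on }(0,1)),\quad \overline{w}^d_j(0)=\overline{w}^d_{jx}(1)=\overline{w}^d_{jxx}(0)=\overline{w}^d_{jxxx}(1)=0,$$ and $$\overline{\psi}^m_{jxxxx}(x)=-\overline{g}_jH^m_{jxxxx}(x)=\overline{\alpha}_j\varphi_m(x-x_j),\quad \overline{\psi}^m_j(0)=\overline{\psi}^m_{jx}(1)=\overline{\psi}^m_{jxx}(0)=\overline{\psi}^m_{jxxx}(1)=0.$$ *)

theory Defs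
  imports "HOL-Analysis.Analysis"
begin

text \<open>
  \<open>has_nth_derivative S k f d x\<close>: the \<open>k\<close>-th derivative of \<open>f\<close> relative to \<open>S\<close> exists at \<open>x\<close> and
  equals \<open>d\<close>. As usual, the derivative of order \<open>k\<close> only has to exist on a neighbourhood of \<open>x\<close>
  in \<open>S\<close> for the derivative of order \<open>k + 1\<close> at \<open>x\<close> to make sense. At an endpoint of an interval
  \<open>S\<close> this is the one-sided derivative, and values of \<open>f\<close> outside \<open>S\<close> are irrelevant.
\<close>

primrec has_nth_derivative ::
  "real set \<Rightarrow> nat \<Rightarrow> (real \<Rightarrow> real) \<Rightarrow> real \<Rightarrow> real \<Rightarrow> bool" where
  "has_nth_derivative S 0 f = (\<lambda>d x. f x = d)"
| "has_nth_derivative S (Suc k) f = (\<lambda>d x. \<exists>g.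
     (\<forall>\<^sub>F y in nhds x. y \<in> S \<longrightarrow> has_nth_derivative S k f (g y) y) \<and>
     (g has_real_derivative d) (at x within S))"

definition C_on :: "nat \<Rightarrow> real set \<Rightarrow> (real \<Rightarrow> real) \<Rightarrow> bool" where
  "C_on k S f \<longleftrightarrow>
     (\<exists>D. continuous_on S D \<and> (\<forall>x\<in>S. has_nth_derivative S k f (D x) x))"

definition C1_convergence ::
  "real set \<Rightarrow> ('a \<Rightarrow> real \<Rightarrow> real) \<Rightarrow> (real \<Rightarrow> real) \<Rightarrow> 'a filter \<Rightarrow> bool" where
  "C1_convergence S f l F \<longleftrightarrow> (\<exists>f' l'.
     (\<forall>\<^sub>F n in F. continuous_on S (f' n) \<and>
        (\<forall>x\<in>S. (f n has_real_derivative f' n x) (at x within S))) \<and>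
     continuous_on S l' \<and> (\<forall>x\<in>S. (l has_real_derivative l' x) (at x within S)) \<and>
     uniform_limit S f l F \<and> uniform_limit S f' l' F)"

text \<open>
  The kernel \<open>sin (m x) / (\<pi> x)\<close>, extended continuously to \<open>x = 0\<close>. The case distinction is
  essential because \<open>0 / 0 = 0\<close> in HOL.
\<close>

definition phi :: "real \<Rightarrow> real \<Rightarrow> real" where
  "phi m x = (if x = 0 then m / pi else (1 / pi) * (sin (m * x) / x))"

definition beam_boundary :: "(real \<Rightarrow> real) \<Rightarrow> real \<Rightarrow> bool" where
  "beam_boundary u c \<longleftrightarrow> u 0 = 0 \<and>
     has_nth_derivative {0..1} 1 u 0 1 \<and>
     has_nth_derivative {0..1} 2 u 0 0 \<and>
     has_nth_derivative {0..1} 3 u c 1"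

definition lifting_function :: "real \<Rightarrow> real \<Rightarrow> (real \<Rightarrow> real) \<Rightarrow> bool" where
  "lifting_function m a H \<longleftrightarrow>
     (\<forall>x\<in>{0..1}. has_nth_derivative {0..1} 4 H (phi m (x - a)) x) \<and> beam_boundary H 1"

definition regularized_steady_state ::
  "(real \<Rightarrow> real) \<Rightarrow> real \<Rightarrow> (real \<Rightarrow> real) \<Rightarrow> bool" where
  "regularized_steady_state H gbar \<psi> \<longleftrightarrow>
     (\<forall>x\<in>{0..1}. \<exists>h. has_nth_derivative {0..1} 4 H h x \<and>
        has_nth_derivative {0..1} 4 \<psi> (- gbar * h) x) \<and>
     beam_boundary \<psi> 0"

text \<open>Test functions on the open interval \<open>(0,1)\<close>, extended by zero to the real line.\<close>

definition test_function :: "(real \<Rightarrow> real) \<Rightarrow> bool" where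
  "test_function \<theta> \<longleftrightarrow>
     (\<forall>k x. (deriv ^^ k) \<theta> field_differentiable (at x)) \<and>
     closure {x. \<theta> x \<noteq> 0} \<subseteq> {0<..<1}"

text \<open>
  The equation \<open>w'''' = \<alpha> \<delta>(x - a)\<close> holds in the sense of distributions on \<open>(0,1)\<close>. Continuity on
  \<open>[0,1]\<close> selects the representative of the distribution for which pointwise boundary values are
  meaningful; all further regularity, up to the endpoints, is a consequence of the equation.
\<close>

definition pointwise_steady_state :: "real \<Rightarrow> real \<Rightarrow> (real \<Rightarrow> real) \<Rightarrow> bool" where
  "pointwise_steady_state a \<alpha> w \<longleftrightarrow> continuous_on {0..1} w \<and>
     (\<forall>\<theta>. test_function \<theta> \<longrightarrow>
        integral {0..1} (\<lambda>x. w x * (deriv ^^ 4) \<theta> x) = \<alpha> * \<theta> a) \<and>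
     beam_boundary w 0"

end

theory Submission
  imports Defs "HOL-Probability.Sinc_Integral"
begin

text \<open>
  Integrating \<open>\<psi>'''' = \<alpha> \<phi>\<^sub>m(x - a)\<close> twice expresses \<open>\<psi>''\<close> through the sine integral \<open>Si\<close> and its primitive
  \<open>t Si t + cos t\<close>. Since \<open>Si t \<longlonglongrightarrow> \<pi>/2\<close>, this primitive is \<open>\<pi>/2 \<bar>t\<bar> + o(\<bar>t\<bar>)\<close>, so \<open>\<psi>''\<close> converges uniformly
  to \<open>- \<alpha> min x a\<close>; two further integrations from the boundary values give the convergence of \<open>\<psi>'\<close>
  and \<open>\<psi>\<close>. On the other side, the explicit Green function satisfies the distributional equation, and a
  continuous function whose fourth distributional derivative vanishes is a cubic polynomial (iterated
  du Bois-Reymond lemma); the four boundary conditions force this cubic to be zero, so \<open>w\<close> is \<open>\<alpha>\<close> times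
  the Green function.
\<close>

subsection \<open>Iterated one-sided derivatives\<close>

text \<open>The predicate only promises some lower-order function near \<open>x\<close>. By
  induction two such functions agree near \<open>x\<close> within the interval, and their
  derivatives coincide because [0,1] has no isolated points.\<close>

lemma has_nth_derivative_unique:
  assumes "has_nth_derivative {0..1} k f c x" "has_nth_derivative {0..1} k f d x" "x \<in> {0..1}"
  shows "c = d"
  using assms
proof (induction k arbitrary: c d x)
  case (Suc k)
  from Suc.prems obtain g h where
    g: "\<forall>\<^sub>F y in nhds x. y \<in> {0..1} \<longrightarrow> has_nth_derivative {0..1} k f (g y) y"
       "(g has_real_derivative c) (at x within {0..1})" and
    h: "\<forall>\<^sub>F y in nhds x. y \<in> {0..1} \<longrightarrow> has_nth_derivative {0..1} k f (h y) y"
       "(h has_real_derivative d) (at x within {0..1})"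
    by (auto simp del: atLeastAtMost_iff)
  have eq: "\<forall>\<^sub>F y in nhds x. y \<in> {0..1} \<longrightarrow> g y = h y"
    using g(1) h(1) by eventually_elim (use Suc.IH in blast)
  then have "(h has_real_derivative c) (at x within {0..1})"
    using g(2) Suc.prems(3) has_field_derivative_cong_ev[OF refl eq refl refl] by blast
  moreover have "at x within {0..1} \<noteq> bot"
    using Suc.prems(3) by (simp add: trivial_limit_within)
  ultimately show ?case
    using h(2) has_field_derivative_unique by blast
qed simp

text \<open>The definition supplies a separate local witness at each point; uniqueness glues them
  into a single function on the whole interval.\<close>

lemma has_nth_derivative_SucD:
  assumes "\<And>x. x \<in> {0..1} \<Longrightarrow> has_nth_derivative {0..1} (Suc k) f (d x) x"
  shows "\<exists>g. \<forall>x\<in>{0..1}. has_nth_derivative {0..1} k f (g x) x \<and>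
    (g has_real_derivative d x) (at x within {0..1})"
proof -
  have "\<exists>c. has_nth_derivative {0..1} k f c x" if "x \<in> {0..1}" for x
    using assms[OF that] eventually_nhds_x_imp_x that by fastforce
  then obtain g where g: "\<And>x. x \<in> {0..1} \<Longrightarrow> has_nth_derivative {0..1} k f (g x) x"
    by metis
  have "(g has_real_derivative d x) (at x within {0..1})" if x: "x \<in> {0..1}" for x
  proof -
    obtain h where h: "\<forall>\<^sub>F y in nhds x. y \<in> {0..1} \<longrightarrow> has_nth_derivative {0..1} k f (h y) y"
       "(h has_real_derivative d x) (at x within {0..1})"
      using assms[OF x] by auto
    have eq: "\<forall>\<^sub>F y in nhds x. y \<in> {0..1} \<longrightarrow> g y = h y"
      using h(1) by eventually_elim (use g has_nth_derivative_unique in blast)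
    then show ?thesis
      using h(2) x has_field_derivative_cong_ev[OF refl eq refl refl] by blast
  qed
  with g show ?thesis by blast
qed

text \<open>The last derivative is asked for at the single point \<open>x\<close> only. This permits
  a third derivative at 1 for functions whose second derivative has a kink inside the
  interval.\<close>

lemma has_nth_derivative_SucI:
  assumes "\<And>y. y \<in> S \<Longrightarrow> f y = D 0 y"
    and "\<And>i y. i < k \<Longrightarrow> y \<in> S \<Longrightarrow> (D i has_real_derivative D (Suc i) y) (at y within S)"
    and "(D k has_real_derivative d) (at x within S)"
  shows "has_nth_derivative S (Suc k) f d x"
  using assms(2,3)
proof (induction k arbitrary: d x)
  case 0
  then show ?case using assms(1) by (auto intro!: exI[of _ "D 0"])
next
  case (Suc k)
  have "has_nth_derivative S (Suc k) f (D (Suc k) y) y" if "y \<in> S" for y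
    by (rule Suc.IH) (use Suc.prems that in auto)
  then show ?case
    using Suc.prems(2) unfolding has_nth_derivative.simps(2)[of S "Suc k"]
    by (intro exI[of _ "D (Suc k)"]) auto
qed

text \<open>Peeling off one order at a time turns the fourth-order equation into four first-order
  relations that can be integrated successively.\<close>

lemma has_nth_derivative_4_chain:
  assumes "\<forall>x\<in>{0..1}. has_nth_derivative {0..1} 4 f (d x) x" "beam_boundary f c"
  shows "\<exists>f1 f2 f3. f 0 = 0 \<and> f1 1 = 0 \<and> f2 0 = 0 \<and> f3 1 = c \<and>
    (\<forall>x\<in>{0..1}. (f has_real_derivative f1 x) (at x within {0..1}) \<and>
      (f1 has_real_derivative f2 x) (at x within {0..1}) \<and>
      (f2 has_real_derivative f3 x) (at x within {0..1}) \<and>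
      (f3 has_real_derivative d x) (at x within {0..1}))"
proof -
  have 4: "has_nth_derivative {0..1} (Suc 3) f (d x) x" if "x \<in> {0..1}" for x
    using bspec[OF assms(1) that] by (simp only: numeral_eq_Suc pred_numeral_simps BitM.simps)
  obtain f3 where f3: "\<And>x. x \<in> {0..1} \<Longrightarrow> has_nth_derivative {0..1} 3 f (f3 x) x"
    "\<And>x. x \<in> {0..1} \<Longrightarrow> (f3 has_real_derivative d x) (at x within {0..1})"
    using has_nth_derivative_SucD[OF 4] by blast
  then have 3: "has_nth_derivative {0..1} (Suc 2) f (f3 x) x" if "x \<in> {0..1}" for x
    using that by (simp only: numeral_eq_Suc pred_numeral_simps BitM.simps)
  obtain f2 where f2: "\<And>x. x \<in> {0..1} \<Longrightarrow> has_nth_derivative {0..1} 2 f (f2 x) x"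
    "\<And>x. x \<in> {0..1} \<Longrightarrow> (f2 has_real_derivative f3 x) (at x within {0..1})"
    using has_nth_derivative_SucD[OF 3] by blast
  then have 2: "has_nth_derivative {0..1} (Suc 1) f (f2 x) x" if "x \<in> {0..1}" for x
    using that by (simp only: numeral_eq_Suc pred_numeral_simps BitM.simps One_nat_def)
  obtain f1 where f1: "\<And>x. x \<in> {0..1} \<Longrightarrow> has_nth_derivative {0..1} 1 f (f1 x) x"
    "\<And>x. x \<in> {0..1} \<Longrightarrow> (f1 has_real_derivative f2 x) (at x within {0..1})"
    using has_nth_derivative_SucD[OF 2] by blast
  then have 1: "has_nth_derivative {0..1} (Suc 0) f (f1 x) x" if "x \<in> {0..1}" for x
    using that by (simp only: One_nat_def)
  obtain f0 where f0: "\<And>x. x \<in> {0..1} \<Longrightarrow> has_nth_derivative {0..1} 0 f (f0 x) x"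
    "\<And>x. x \<in> {0..1} \<Longrightarrow> (f0 has_real_derivative f1 x) (at x within {0..1})"
    using has_nth_derivative_SucD[OF 1] by blast
  have "(f has_real_derivative f1 x) (at x within {0..1})" if "x \<in> {0..1}" for x
  proof -
    have "\<forall>\<^sub>F y in nhds x. y \<in> {0..1} \<longrightarrow> f y = f0 y"
      using f0(1) by (intro always_eventually) simp
    from has_field_derivative_cong_ev[OF refl this refl refl that] show ?thesis
      using f0(2)[OF that] by blast
  qed
  \<comment> \<open>The boundary conditions are stated through the derivative predicate; uniqueness
    identifies their values with those of the chain.\<close>
  moreover have "f 0 = 0" "f1 1 = 0" "f2 0 = 0" "f3 1 = c"
    using assms(2) has_nth_derivative_unique[OF f1(1)[of 1], of 0]
      has_nth_derivative_unique[OF f2(1)[of 0], of 0] has_nth_derivative_unique[OF f3(1)[of 1], of c]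
    by (simp_all add: beam_boundary_def del: has_nth_derivative.simps One_nat_def)
  ultimately show ?thesis using f1(2) f2(2) f3(2) by blast
qed

subsection \<open>Test functions\<close>

definition smooth :: "(real \<Rightarrow> real) \<Rightarrow> bool" where
  "smooth f \<longleftrightarrow> (\<forall>k x. (deriv ^^ k) f field_differentiable (at x))"

lemma smooth_has_derivative:
  assumes "smooth f" shows "((deriv ^^ k) f has_real_derivative (deriv ^^ Suc k) f x) (at x)"
  using assms by (simp add: smooth_def DERIV_deriv_iff_field_differentiable)

lemma smooth_higher_deriv: "smooth f \<Longrightarrow> smooth ((deriv ^^ k) f)"
  unfolding smooth_def by (metis comp_apply funpow_add)

lemma smooth_continuous_on: "smooth f \<Longrightarrow> continuous_on S f"
  using smooth_has_derivative[of f 0]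
  by (intro DERIV_continuous_on[of S f "deriv f", OF has_field_derivative_at_within]) simp

lemma smooth_antiderivative:
  assumes "smooth f" and F: "\<And>x. (F has_real_derivative f x) (at x)"
  shows "(deriv ^^ Suc k) F = (deriv ^^ k) f" and "smooth F"
proof -
  have "deriv F = f" using F by (auto simp: DERIV_imp_deriv)
  then show *: "(deriv ^^ Suc k) F = (deriv ^^ k) f" for k
    by (simp add: funpow_swap1)
  show "smooth F"
    unfolding smooth_def
  proof (intro allI)
    fix k x
    show "(deriv ^^ k) F field_differentiable at x"
      using F assms(1) by (cases k)
        (auto simp: * smooth_def field_differentiable_def simp del: funpow.simps(2) simp: funpow_0)
  qed
qed

lemma smooth_diff_cmult:
  assumes "smooth f" "smooth g"
  shows "(deriv ^^ k) (\<lambda>x. f x - c * g x) = (\<lambda>x. (deriv ^^ k) f x - c * (deriv ^^ k) g x)"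
    and "smooth (\<lambda>x. f x - c * g x)"
proof -
  have D: "((\<lambda>x. (deriv ^^ k) f x - c * (deriv ^^ k) g x) has_real_derivative
      ((deriv ^^ Suc k) f x - c * (deriv ^^ Suc k) g x)) (at x)" for k x
    by (intro DERIV_diff DERIV_cmult smooth_has_derivative assms)
  show *: "(deriv ^^ k) (\<lambda>x. f x - c * g x) = (\<lambda>x. (deriv ^^ k) f x - c * (deriv ^^ k) g x)" for k
  proof (induction k)
    case (Suc k)
    then show ?case using D[of k] by (auto simp: DERIV_imp_deriv)
  qed simp
  show "smooth (\<lambda>x. f x - c * g x)"
    unfolding smooth_def * using D field_differentiable_def by blast
qed

lemma test_functionI:
  assumes "smooth f" "0 < l" "r < 1" "\<And>x. x < l \<Longrightarrow> f x = 0" "\<And>x. x > r \<Longrightarrow> f x = 0"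
  shows "test_function f"
proof -
  have "closure {x. f x \<noteq> 0} \<subseteq> {l..r}"
    by (rule closure_minimal) (use assms(4,5) in \<open>auto simp: not_less[symmetric]\<close>)
  then show ?thesis using assms(1-3) by (force simp: test_function_def smooth_def)
qed

text \<open>A compact support inside the open interval keeps away from both endpoints, which yields
  the explicit margins \<open>l\<close> and \<open>r\<close>.\<close>

lemma test_functionE:
  assumes "test_function f"
  obtains l r where "smooth f" "0 < l" "l < r" "r < 1" "\<And>x. x < l \<Longrightarrow> f x = 0" "\<And>x. x > r \<Longrightarrow> f x = 0"
proof -
  let ?K = "closure {x. f x \<noteq> 0}"
  have K: "?K \<subseteq> {0<..<1}" and smooth: "smooth f"
    using assms by (auto simp: test_function_def smooth_def)
  have "bounded {x. f x \<noteq> 0}"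
    by (rule bounded_subset[OF _ order_trans[OF closure_subset K]]) simp
  \<comment> \<open>The points 1/3 and 2/3 make the compact set nonempty and force
    \<open>l < r\<close> even for the zero function.\<close>
  then have "compact (?K \<union> {1/3, 2/3})" by (auto simp: compact_Un)
  then obtain l r where l: "l \<in> ?K \<union> {1/3, 2/3}" "\<And>x. x \<in> ?K \<union> {1/3, 2/3} \<Longrightarrow> l \<le> x"
    and r: "r \<in> ?K \<union> {1/3, 2/3}" "\<And>x. x \<in> ?K \<union> {1/3, 2/3} \<Longrightarrow> x \<le> r"
    using compact_attains_inf[of "?K \<union> {1/3, 2/3}"] compact_attains_sup[of "?K \<union> {1/3, 2/3}"] by blast
  show thesis
  proof (rule that[of l r])
    show "l < r" using l(2)[of "1/3"] r(2)[of "2/3"] by simp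
    show "0 < l" "r < 1" using K l(1) r(1) by auto
    show "f x = 0" if "x < l" for x
      using that l(2)[of x] closure_subset[of "{x. f x \<noteq> 0}"] by force
    show "f x = 0" if "x > r" for x
      using that r(2)[of x] closure_subset[of "{x. f x \<noteq> 0}"] by force
  qed (rule smooth)
qed

lemma test_function_diff_cmult:
  assumes "test_function f" "test_function g"
  shows "test_function (\<lambda>x. f x - c * g x)"
proof -
  obtain l r where f: "smooth f" "0 < l" "r < 1" "\<And>x. x < l \<Longrightarrow> f x = 0" "\<And>x. x > r \<Longrightarrow> f x = 0"
    using assms(1) by (elim test_functionE) blast
  obtain l' r' where g: "smooth g" "0 < l'" "r' < 1" "\<And>x. x < l' \<Longrightarrow> g x = 0" "\<And>x. x > r' \<Longrightarrow> g x = 0"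
    using assms(2) by (elim test_functionE) blast
  show ?thesis
    by (rule test_functionI[of _ "min l l'" "max r r'"]) (use f g smooth_diff_cmult(2) in auto)
qed

text \<open>The function is zero on the open set left of \<open>l\<close> and right of
  \<open>r\<close>, so its derivative vanishes there with the same margins.\<close>

lemma test_function_deriv:
  assumes "test_function f"
  shows "test_function ((deriv ^^ k) f)"
proof (induction k)
  case (Suc k)
  from Suc.IH obtain l r where *: "smooth ((deriv ^^ k) f)" "0 < l" "r < 1"
    "\<And>x. x < l \<Longrightarrow> (deriv ^^ k) f x = 0" "\<And>x. x > r \<Longrightarrow> (deriv ^^ k) f x = 0"
    by (elim test_functionE) blast
  have "deriv ((deriv ^^ k) f) x = 0" if "x < l \<or> x > r" for x
  proof -
    have "\<forall>\<^sub>F y in nhds x. (deriv ^^ k) f y = 0"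
    proof (rule eventually_nhds_in_open[of "{..<l} \<union> {r<..}", THEN eventually_mono])
      show "open ({..<l} \<union> {r<..})" by (intro open_Un) auto
    qed (use that * in auto)
    then have "deriv ((deriv ^^ k) f) x = deriv (\<lambda>_. 0) x"
      by (intro deriv_cong_ev) auto
    then show ?thesis by simp
  qed
  then show ?case
    using smooth_higher_deriv[OF *(1), of 1] *(2,3) by (intro test_functionI[of _ l r]) auto
qed (simp add: assms)

lemma test_function_has_derivative:
  "test_function f \<Longrightarrow> ((deriv ^^ k) f has_real_derivative (deriv ^^ Suc k) f x) (at x within S)"
  by (rule has_field_derivative_at_within, rule smooth_has_derivative) (auto elim: test_functionE)

lemma test_function_continuous_on: "test_function f \<Longrightarrow> continuous_on S ((deriv ^^ k) f)"
  by (meson test_functionE test_function_deriv smooth_continuous_on)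

lemma test_function_outside:
  assumes "test_function f" "x \<le> 0 \<or> x \<ge> 1"
  shows "(deriv ^^ k) f x = 0"
proof -
  obtain l r where "0 < l" "r < 1"
    "\<And>x. x < l \<Longrightarrow> (deriv ^^ k) f x = 0" "\<And>x. x > r \<Longrightarrow> (deriv ^^ k) f x = 0"
    using test_function_deriv[OF assms(1), of k] by (elim test_functionE) blast
  then show ?thesis using assms(2) by force
qed

text \<open>The primitive starting at 0 is constant to the right of the support, and the zero mean
  makes that constant 0; hence the primitive has compact support again.\<close>

lemma test_function_antiderivative:
  assumes "test_function f" "integral {0..1} f = 0"
  shows "\<exists>F. test_function F \<and> (\<forall>k. (deriv ^^ Suc k) F = (deriv ^^ k) f)"
proof -
  obtain l r where *: "smooth f" "0 < l" "l < r" "r < 1" "\<And>x. x < l \<Longrightarrow> f x = 0" "\<And>x. x > r \<Longrightarrow> f x = 0"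
    using assms(1) by (elim test_functionE) blast
  define F where "F = (\<lambda>x. integral {0..x} f)"
  have cont: "continuous_on S f" for S using *(1) by (rule smooth_continuous_on)
  have F0: "F x = 0" if "x < l" for x
    using that *(5) integral_cong[of "{0..x}" f "\<lambda>_. 0"] by (simp add: F_def)
  have F1: "F x = 0" if "x > r" for x
  proof -
    have "integral {0..y} f = integral {0..r} f" if "y > r" for y
    proof -
      have "integral {0..r} f + integral {r..y} f = integral {0..y} f"
        by (rule Henstock_Kurzweil_Integration.integral_combine)
          (use * that cont in \<open>auto intro: integrable_continuous_real\<close>)
      moreover have "integral {r..y} f = integral {r..y} (\<lambda>_. 0)"
        by (rule integral_spike[of "{r}"]) (use *(6) in auto)
      ultimately show ?thesis by simp
    qed
    \<comment> \<open>Both \<open>x\<close> and 1 lie beyond \<open>r\<close>, so \<open>F x\<close>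
      equals the total integral.\<close>
    from this[OF that] this[OF *(4)] show ?thesis by (simp add: F_def assms(2))
  qed
  have "(F has_real_derivative f x) (at x)" for x
  proof -
    \<comment> \<open>These open regions cover the line because \<open>0 < l\<close> and
      \<open>r < 1\<close>. On the outer two \<open>F\<close> is locally zero, so the fundamental
      theorem is applied only inside (0,1).\<close>
    consider "x < l" | "x > r" | "x \<in> {0<..<1}" using * by fastforce
    then show ?thesis
    proof cases
      case 1
      then have "\<forall>\<^sub>F y in nhds x. F y = 0"
        using eventually_nhds_in_open[of "{..<l}" x] by (auto elim!: eventually_mono intro: F0)
      then have "(F has_real_derivative 0) (at x) = ((\<lambda>_. 0) has_real_derivative 0) (at x)"
        by (intro DERIV_cong_ev) auto
      then show ?thesis using *(5)[OF 1] by simp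
    next
      case 2
      then have "\<forall>\<^sub>F y in nhds x. F y = 0"
        using eventually_nhds_in_open[of "{r<..}" x] by (auto elim!: eventually_mono intro: F1)
      then have "(F has_real_derivative 0) (at x) = ((\<lambda>_. 0) has_real_derivative 0) (at x)"
        by (intro DERIV_cong_ev) auto
      then show ?thesis using *(6)[OF 2] by simp
    next
      case 3
      then show ?thesis
        using integral_has_real_derivative[OF cont, of x 0 1] at_within_Icc_at[of 0 x 1]
        by (simp add: F_def)
    qed
  qed
  note F = smooth_antiderivative[OF *(1) this]
  show ?thesis
    using test_functionI[OF F(2) *(2,4) F0 F1] F(1) by blast
qed

section \<open>Construction of smooth bump functions\<close>

definition flat :: "nat \<Rightarrow> real \<Rightarrow> real" where
  "flat n x = (if x > 0 then exp (- 1 / x) / x ^ n else 0)"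

text \<open>With u = 1/x this is the decay of u^n / exp u at infinity.\<close>

lemma flat_tendsto_0: "(flat n \<longlongrightarrow> 0) (at_right 0)"
proof -
  have "((\<lambda>x. inverse x ^ n / exp (inverse x)) \<longlongrightarrow> (0::real)) (at_right 0)"
    by (rule filterlim_compose[OF tendsto_power_div_exp_0 filterlim_inverse_at_top_right])
  then show ?thesis
    by (rule Lim_transform_eventually)
      (auto simp: eventually_at_filter flat_def exp_minus divide_simps intro!: always_eventually)
qed

text \<open>At 0 the difference quotient of \<open>flat n\<close> is \<open>flat (Suc n)\<close> on
  the right and 0 on the left. The powers in the denominator are included so that differentiation
  stays within linear combinations of the family.\<close>

lemma flat_has_derivative:
  "(flat n has_real_derivative flat (n + 2) x - real n * flat (n + 1) x) (at x)"
proof -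
  consider "x > 0" | "x < 0" | "x = 0" by linarith
  then show ?thesis
  proof cases
    case 1
    have "((\<lambda>x. exp (- 1 / x) / x ^ n) has_real_derivative flat (n + 2) x - real n * flat (n + 1) x) (at x)"
    proof -
      have "((\<lambda>x. exp (- 1 / x) / x ^ n) has_real_derivative
          (exp (- 1 / x) * (1 / x\<^sup>2) * x ^ n - exp (- 1 / x) * (real n * x ^ (n - 1))) / (x ^ n * x ^ n)) (at x)"
        using 1 by (auto intro!: derivative_eq_intros simp: power2_eq_square)
      moreover have "(exp (- 1 / x) * (1 / x\<^sup>2) * x ^ n - exp (- 1 / x) * (real n * x ^ (n - 1))) / (x ^ n * x ^ n)
         = flat (n + 2) x - real n * flat (n + 1) x"
        using 1 by (cases n) (auto simp: flat_def field_simps power2_eq_square)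
      ultimately show ?thesis by simp
    qed
    moreover have "\<forall>\<^sub>F y in nhds x. flat n y = exp (- 1 / y) / y ^ n"
      using eventually_nhds_in_open[of "{0<..}" x] 1 by (auto elim!: eventually_mono simp: flat_def)
    then have "(flat n has_real_derivative D) (at x) =
        ((\<lambda>x. exp (- 1 / x) / x ^ n) has_real_derivative D) (at x)" for D
      by (intro DERIV_cong_ev) auto
    ultimately show ?thesis by simp
  next
    case 2
    have "\<forall>\<^sub>F y in nhds x. flat n y = 0"
      using eventually_nhds_in_open[of "{..<0}" x] 2 by (auto elim!: eventually_mono simp: flat_def)
    then have "(flat n has_real_derivative 0) (at x) = ((\<lambda>_. 0) has_real_derivative 0) (at x)"
      by (intro DERIV_cong_ev) auto
    then show ?thesis using 2 by (simp add: flat_def)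
  next
    case 3
    have "((\<lambda>h. flat n h / h) \<longlongrightarrow> 0) (at_right 0)"
      by (rule Lim_transform_eventually[OF flat_tendsto_0[of "Suc n"]])
        (auto simp: eventually_at_filter flat_def)
    moreover have "((\<lambda>h. flat n h / h) \<longlongrightarrow> 0) (at_left 0)"
      by (rule Lim_transform_eventually[OF tendsto_const])
        (auto simp: eventually_at_filter flat_def)
    ultimately have "((\<lambda>h. flat n h / h) \<longlongrightarrow> 0) (at 0)"
      by (simp add: filterlim_at_split)
    then show ?thesis using 3 by (simp add: DERIV_def flat_def)
  qed
qed

text \<open>Closure of this family under differentiation is what makes the bump functions smooth.\<close>

inductive bump_span :: "real \<Rightarrow> real \<Rightarrow> (real \<Rightarrow> real) \<Rightarrow> bool" for l r where
  product: "bump_span l r (\<lambda>x. c * (flat i (x - l) * flat j (r - x)))"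
| add: "bump_span l r f \<Longrightarrow> bump_span l r g \<Longrightarrow> bump_span l r (\<lambda>x. f x + g x)"

lemma bump_span_has_derivative:
  assumes "bump_span l r f"
  shows "\<exists>f'. bump_span l r f' \<and> (\<forall>x. (f has_real_derivative f' x) (at x))"
  using assms
proof induction
  case (product c i j)
  \<comment> \<open>The terms of the product rule are grouped to match the rules of
    \<open>bump_span\<close> literally, with all signs absorbed into the coefficients.\<close>
  let ?f' = "\<lambda>x. (c * (flat (i + 2) (x - l) * flat j (r - x)) +
      (- c * real i) * (flat (i + 1) (x - l) * flat j (r - x))) +
      ((- c) * (flat i (x - l) * flat (j + 2) (r - x)) +
      (c * real j) * (flat i (x - l) * flat (j + 1) (r - x)))"
  have "((\<lambda>x. c * (flat i (x - l) * flat j (r - x))) has_real_derivative ?f' x) (at x)" for x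
  proof -
    have "((\<lambda>x. flat i (x - l)) has_real_derivative
        (flat (i + 2) (x - l) - real i * flat (i + 1) (x - l)) * 1) (at x)"
      by (rule DERIV_chain'[OF _ flat_has_derivative]) (auto intro!: derivative_eq_intros)
    moreover have "((\<lambda>x. flat j (r - x)) has_real_derivative
        (flat (j + 2) (r - x) - real j * flat (j + 1) (r - x)) * (- 1)) (at x)"
      by (rule DERIV_chain'[OF _ flat_has_derivative]) (auto intro!: derivative_eq_intros)
    ultimately have "((\<lambda>x. c * (flat i (x - l) * flat j (r - x))) has_real_derivative
      c * (((flat (i + 2) (x - l) - real i * flat (i + 1) (x - l)) * 1) * flat j (r - x) +
        ((flat (j + 2) (r - x) - real j * flat (j + 1) (r - x)) * (- 1)) * flat i (x - l))) (at x)"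
      by (intro DERIV_cmult DERIV_mult)
    then show ?thesis by (simp add: algebra_simps)
  qed
  moreover have "bump_span l r ?f'" by (intro bump_span.intros)
  ultimately show ?case by blast
next
  case (add f g)
  then obtain f' g' where "bump_span l r f'" "bump_span l r g'"
    "\<forall>x. (f has_real_derivative f' x) (at x)" "\<forall>x. (g has_real_derivative g' x) (at x)" by blast
  then show ?case
    by (intro exI[of _ "\<lambda>x. f' x + g' x"]) (auto intro: bump_span.add DERIV_add)
qed

text \<open>By induction every iterated derivative stays in the span, and every member of the span
  is differentiable.\<close>

lemma bump_span_smooth:
  assumes "bump_span l r f" shows "smooth f"
proof -
  have "bump_span l r ((deriv ^^ k) f)" for k
  proof (induction k)
    case (Suc k)
    then obtain f' where "bump_span l r f'" "\<And>x. ((deriv ^^ k) f has_real_derivative f' x) (at x)"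
      using bump_span_has_derivative by blast
    moreover from this(2) have "deriv ((deriv ^^ k) f) = f'" by (auto simp: DERIV_imp_deriv)
    ultimately show ?case by simp
  qed (simp add: assms)
  then show ?thesis
    using bump_span_has_derivative unfolding smooth_def field_differentiable_def by blast
qed

text \<open>The product of a flat function starting at \<open>l\<close> and a reflected one ending
  at \<open>r\<close> is positive exactly where both factors are.\<close>

lemma bump_function_exists:
  assumes "0 < l" "r < 1"
  obtains b where "test_function b" "\<And>x. x \<in> {l<..<r} \<Longrightarrow> b x > 0" "\<And>x. x \<notin> {l<..<r} \<Longrightarrow> b x = 0"
proof
  let ?b = "\<lambda>x. 1 * (flat 0 (x - l) * flat 0 (r - x))"
  show "test_function ?b"
    by (rule test_functionI[OF bump_span_smooth[OF bump_span.product] assms]) (auto simp: flat_def)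
qed (auto simp: flat_def)

section \<open>The du Bois-Reymond lemma and its iteration\<close>

lemma weak_zero:
  assumes v: "continuous_on {0..1} v"
    and int: "\<And>\<theta>. test_function \<theta> \<Longrightarrow> integral {0..1} (\<lambda>x. v x * \<theta> x) = 0"
    and x: "x \<in> {0..1}"
  shows "v x = 0"
proof -
  \<comment> \<open>Were \<open>u\<close> positive at an interior point \<open>p\<close>, a bump
    concentrated near \<open>p\<close> would give a nonnegative continuous integrand with zero
    integral that is positive at \<open>p\<close>.\<close>
  have nonpos: "u p \<le> 0" if u: "continuous_on {0..1} u" and
    int: "\<And>\<theta>. test_function \<theta> \<Longrightarrow> integral {0..1} (\<lambda>x. u x * \<theta> x) = 0" and p: "p \<in> {0<..<1}"
    for u p
  proof (rule ccontr)
    assume "\<not> u p \<le> 0"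
    then obtain d where d: "d > 0" "\<And>y. y \<in> {0..1} \<Longrightarrow> dist y p < d \<Longrightarrow> dist (u y) (u p) < u p"
      using u p unfolding continuous_on_iff by (metis atLeastAtMost_iff greaterThanLessThan_iff less_le_not_le not_le)
    \<comment> \<open>The halves put the support of the bump strictly inside (0,1) and within the
      distance \<open>d\<close> on which continuity keeps \<open>u\<close> positive.\<close>
    define e where "e = min (d / 2) (min (p / 2) ((1 - p) / 2))"
    have e: "e > 0" "e < d" "e < p" "e < 1 - p" using d(1) p by (auto simp: e_def min_def)
    obtain b where b: "test_function b" "\<And>x. x \<in> {p - e<..<p + e} \<Longrightarrow> b x > 0"
      "\<And>x. x \<notin> {p - e<..<p + e} \<Longrightarrow> b x = 0"
      using bump_function_exists[of "p - e" "p + e"] e by auto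
    have pos: "u y * b y \<ge> 0" if "y \<in> {0..1}" for y
    proof (cases "y \<in> {p - e<..<p + e}")
      case True
      then have "dist y p < d" using e by (auto simp: dist_real_def abs_if)
      then have "u y > 0" using d(2)[OF that] by (auto simp: dist_real_def abs_if split: if_splits)
      then show ?thesis using b(2)[OF True] by simp
    qed (simp add: b(3))
    have "continuous_on {0..1} (\<lambda>y. u y * b y)"
      using test_function_continuous_on[OF b(1), of _ 0] u by (auto intro: continuous_on_mult)
    then have "\<forall>y\<in>{0..1}. u y * b y = 0"
      using integral_eq_0_iff[of 0 1 "\<lambda>y. u y * b y"] pos int[OF b(1)] by simp
    then have "u p * b p = 0" using p by simp
    moreover have "b p > 0" using b(2)[of p] e by simp
    ultimately show False using \<open>\<not> u p \<le> 0\<close> by simp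
  qed
  \<comment> \<open>The bound for both \<open>v\<close> and its negative gives zero in the interior;
    the endpoints follow since the zero set is closed.\<close>
  have "v y = 0" if "y \<in> {0<..<1}" for y
    using nonpos[OF v int that] nonpos[of "\<lambda>x. - v x" y] v int that by (simp add: continuous_on_minus)
  then have "{0<..<1} \<subseteq> {y \<in> {0..1}. v y = 0}" by auto
  moreover have "closed {y \<in> {0..1}. v y = 0}"
    using continuous_closed_preimage_constant[OF v, of 0] by simp
  ultimately have "closure {0<..<1} \<subseteq> {y \<in> {0..1}. v y = 0}" by (rule closure_minimal)
  then show ?thesis using x by auto
qed

text \<open>The boundary terms vanish, as a test function and all its derivatives are zero at 0 and
  1.\<close>

lemma test_function_by_parts:
  assumes "test_function \<theta>" and u: "\<And>x. x \<in> {0..1} \<Longrightarrow> (u has_real_derivative u' x) (at x within {0..1})"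
    and u': "continuous_on {0..1} u'"
  shows "integral {0..1} (\<lambda>x. u x * (deriv ^^ Suc k) \<theta> x) = - integral {0..1} (\<lambda>x. u' x * (deriv ^^ k) \<theta> x)"
proof -
  let ?a = "\<lambda>x. u x * (deriv ^^ Suc k) \<theta> x" and ?b = "\<lambda>x. u' x * (deriv ^^ k) \<theta> x"
  have "((\<lambda>x. ?b x + ?a x) has_integral u 1 * (deriv ^^ k) \<theta> 1 - u 0 * (deriv ^^ k) \<theta> 0) {0..1}"
  proof (rule fundamental_theorem_of_calculus)
    fix x :: real assume "x \<in> {0..1}"
    from DERIV_mult[OF u[OF this] test_function_has_derivative[OF assms(1), of k]]
    show "((\<lambda>x. u x * (deriv ^^ k) \<theta> x) has_vector_derivative ?b x + ?a x) (at x within {0..1})"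
      by (simp add: has_real_derivative_iff_has_vector_derivative mult.commute)
  qed simp
  then have "integral {0..1} (\<lambda>x. ?b x + ?a x) = 0"
    using test_function_outside[OF assms(1)] by (simp add: integral_unique)
  moreover have "continuous_on {0..1} u" using u by (rule DERIV_continuous_on)
  then have "?a integrable_on {0..1}" "?b integrable_on {0..1}"
    using u' test_function_continuous_on[OF assms(1)]
    by (auto intro!: integrable_continuous_real continuous_on_mult simp del: funpow.simps)
  ultimately show ?thesis
    using Henstock_Kurzweil_Integration.integral_add[of ?b "{0..1}" ?a] by linarith
qed

text \<open>Each integration by parts lowers the power and the order by one and contributes a factor
  minus the current power. The value fixes the coefficient of the top monomial in the iterated lemma
  below.\<close>

lemma integral_power_times_deriv:
  assumes "test_function \<theta>"
  shows "integral {0..1} (\<lambda>x. x ^ n * (deriv ^^ n) \<theta> x) = (- 1) ^ n * fact n * integral {0..1} \<theta>"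
proof (induction n)
  case (Suc n)
  have "integral {0..1} (\<lambda>x. x ^ Suc n * (deriv ^^ Suc n) \<theta> x) =
      - integral {0..1} (\<lambda>x. (real (Suc n) * x ^ n) * (deriv ^^ n) \<theta> x)"
  proof (rule test_function_by_parts[OF assms])
    show "((\<lambda>x. x ^ Suc n) has_real_derivative real (Suc n) * x ^ n) (at x within {0..1})" for x
      using DERIV_pow[of "Suc n" x "{0..1}"] by simp
  qed (intro continuous_intros)
  also have "integral {0..1} (\<lambda>x. (real (Suc n) * x ^ n) * (deriv ^^ n) \<theta> x) =
      real (Suc n) * integral {0..1} (\<lambda>x. x ^ n * (deriv ^^ n) \<theta> x)"
    by (simp only: mult.assoc integral_mult_right)
  finally show ?case by (simp only: Suc) (simp add: algebra_simps)
qed simp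

text \<open>
  The induction step uses that a test function, after subtracting a multiple of a fixed bump \<open>b\<close>, is
  the derivative of a test function; the multiple of \<open>b\<close> contributes the monomial of degree \<open>k\<close>.
\<close>

lemma weak_polynomial:
  assumes "continuous_on {0..1} v"
    and "\<And>\<theta>. test_function \<theta> \<Longrightarrow> integral {0..1} (\<lambda>x. v x * (deriv ^^ k) \<theta> x) = 0"
  shows "\<exists>c. \<forall>x\<in>{0..1}. v x = (\<Sum>i<k. c i * x ^ i)"
  using assms
proof (induction k arbitrary: v)
  case 0
  have "v x = 0" if "x \<in> {0..1}" for x
    by (rule weak_zero[OF 0(1) _ that]) (drule 0(2), simp)
  then show ?case by simp
next
  case (Suc k)
  obtain b where b: "test_function b" "\<And>x. x \<in> {1/3<..<2/3} \<Longrightarrow> b x > 0" "\<And>x. x \<notin> {1/3<..<2/3} \<Longrightarrow> b x = 0"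
    by (rule bump_function_exists[of "1/3" "2/3"]) auto
  have "b x \<ge> 0" for x using b(2,3)[of x] by (cases "x \<in> {1/3<..<2/3}") auto
  moreover have "continuous_on {0..1} b"
    using test_function_continuous_on[OF b(1), of _ 0] by simp
  ultimately have "integral {0..1} b = 0 \<longleftrightarrow> (\<forall>x\<in>{0..1}. b x = 0)"
    by (intro integral_eq_0_iff) auto
  moreover have "b (1/2) > 0" by (rule b(2)) simp
  moreover have "(1/2::real) \<in> {0..1}" by simp
  ultimately have I: "integral {0..1} b \<noteq> 0" by (metis less_irrefl)
  \<comment> \<open>Testing \<open>v\<close> against k-th derivatives turns out to be
    \<open>J\<close> times the integral of the test function. For \<open>x ^ k\<close> the
    corresponding factor is \<open>(- 1) ^ k * fact k\<close>, so the quotient \<open>C\<close> is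
    the coefficient of \<open>x ^ k\<close> in \<open>v\<close>.\<close>
  define J where "J = integral {0..1} (\<lambda>x. v x * (deriv ^^ k) b x) / integral {0..1} b"
  define C where "C = J / ((- 1) ^ k * fact k)"
  have int: "(\<lambda>x. u x * (deriv ^^ j) \<theta> x) integrable_on {0..1}"
    if "continuous_on {0..1} u" "test_function \<theta>" for u \<theta> j
    by (intro integrable_continuous_real continuous_on_mult test_function_continuous_on that)
  have vk: "integral {0..1} (\<lambda>x. v x * (deriv ^^ k) \<theta> x) = J * integral {0..1} \<theta>" if \<theta>: "test_function \<theta>" for \<theta>
  proof -
    \<comment> \<open>Chosen to give \<open>?\<eta>\<close> mean zero.\<close>
    define c where "c = integral {0..1} \<theta> / integral {0..1} b"
    let ?\<eta> = "\<lambda>x. \<theta> x - c * b x"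
    have "integral {0..1} ?\<eta> = integral {0..1} \<theta> - c * integral {0..1} b"
      using int[of "\<lambda>_. 1" _ 0] \<theta> b(1)
      by (subst Henstock_Kurzweil_Integration.integral_diff) (auto intro: integrable_on_mult_right)
    also have "\<dots> = 0" using I by (simp only: c_def nonzero_eq_divide_eq) simp
    finally obtain F where F: "test_function F" "\<And>k. (deriv ^^ Suc k) F = (deriv ^^ k) ?\<eta>"
      using test_function_antiderivative[OF test_function_diff_cmult[OF \<theta> b(1)]] by blast
    have smooth: "smooth \<theta>" "smooth b" using \<theta> b(1) by (auto simp: test_function_def smooth_def)
    have "(\<lambda>x. v x * (deriv ^^ Suc k) F x) = (\<lambda>x. v x * (deriv ^^ k) \<theta> x - c * (v x * (deriv ^^ k) b x))"
      unfolding F(2) smooth_diff_cmult(1)[OF smooth] by (rule ext) (simp add: right_diff_distrib)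
    then have "0 = integral {0..1} (\<lambda>x. v x * (deriv ^^ k) \<theta> x - c * (v x * (deriv ^^ k) b x))"
      using Suc.prems(2)[OF F(1)] by (simp only:)
    also have "\<dots> = integral {0..1} (\<lambda>x. v x * (deriv ^^ k) \<theta> x) - c * integral {0..1} (\<lambda>x. v x * (deriv ^^ k) b x)"
      using int[OF Suc.prems(1)] \<theta> b(1)
      by (subst Henstock_Kurzweil_Integration.integral_diff) (auto intro: integrable_on_mult_right)
    finally show ?thesis by (simp add: c_def J_def)
  qed
  \<comment> \<open>Removing the top monomial leaves a function whose weak derivative of order
    \<open>k\<close> vanishes, to which the induction hypothesis applies.\<close>
  have "\<exists>c. \<forall>x\<in>{0..1}. v x - C * x ^ k = (\<Sum>i<k. c i * x ^ i)"
  proof (rule Suc.IH)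
    show "continuous_on {0..1} (\<lambda>x. v x - C * x ^ k)" by (intro continuous_intros Suc.prems)
    fix \<theta> assume \<theta>: "test_function \<theta>"
    have "integral {0..1} (\<lambda>x. (v x - C * x ^ k) * (deriv ^^ k) \<theta> x) =
        integral {0..1} (\<lambda>x. v x * (deriv ^^ k) \<theta> x - C * (x ^ k * (deriv ^^ k) \<theta> x))"
      by (simp add: algebra_simps)
    also have "\<dots> = J * integral {0..1} \<theta> - C * ((- 1) ^ k * fact k * integral {0..1} \<theta>)"
      using int[OF Suc.prems(1) \<theta>] int[OF continuous_on_power[OF continuous_on_id] \<theta>]
      by (subst Henstock_Kurzweil_Integration.integral_diff)
        (auto intro!: integrable_on_mult_right continuous_intros simp: vk[OF \<theta>] integral_power_times_deriv[OF \<theta>])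
    also have "\<dots> = 0" by (simp add: C_def)
    finally show "integral {0..1} (\<lambda>x. (v x - C * x ^ k) * (deriv ^^ k) \<theta> x) = 0" .
  qed
  then obtain c where c: "\<forall>x\<in>{0..1}. v x - C * x ^ k = (\<Sum>i<k. c i * x ^ i)" by blast
  have "v x = (\<Sum>i<Suc k. (c(k := C)) i * x ^ i)" if "x \<in> {0..1}" for x
  proof -
    have "(\<Sum>i<k. (c(k := C)) i * x ^ i) = (\<Sum>i<k. c i * x ^ i)" by (rule sum.cong) auto
    then show ?thesis using c that by (simp add: algebra_simps)
  qed
  then show ?case by blast
qed

subsection \<open>The steady state of the point load\<close>

text \<open>
  For \<open>k \<le> 2\<close>, \<open>green a k\<close> is the \<open>k\<close>-th derivative of the solution \<open>G\<close> of \<open>G'''' = \<delta>(x - a)\<close> with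
  \<open>G(0) = G'(1) = G''(0) = G'''(1) = 0\<close>; thus \<open>G''(x) = - min x a\<close>. Larger \<open>k\<close> are junk.
\<close>

definition green :: "real \<Rightarrow> nat \<Rightarrow> real \<Rightarrow> real" where
  "green a k x =
    (if k = 0 then max (x - a) 0 ^ 3 / 6 - x ^ 3 / 6 + (1 - (1 - a)\<^sup>2) / 2 * x
     else if k = 1 then (max (x - a) 0)\<^sup>2 / 2 - x\<^sup>2 / 2 + (1 - (1 - a)\<^sup>2) / 2
     else max (x - a) 0 - x)"

text \<open>The exponent is at least 2, so at the kink the difference quotient
  \<open>max h 0 ^ Suc n\<close> still tends to 0.\<close>

lemma truncated_power_has_derivative:
  "((\<lambda>x. max (x - a) 0 ^ Suc (Suc n)) has_real_derivative
     real (Suc (Suc n)) * max (x - a) 0 ^ Suc n) (at x within S)" for a :: real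
proof (rule has_field_derivative_at_within)
  consider "x < a" | "x > a" | "x = a" by linarith
  then show "((\<lambda>x. max (x - a) 0 ^ Suc (Suc n)) has_real_derivative
     real (Suc (Suc n)) * max (x - a) 0 ^ Suc n) (at x)"
  proof cases
    case 1
    have "\<forall>\<^sub>F y in nhds x. max (y - a) 0 ^ Suc (Suc n) = 0"
      using eventually_nhds_in_open[of "{..<a}" x] 1 by (auto elim!: eventually_mono)
    then have "((\<lambda>x. max (x - a) 0 ^ Suc (Suc n)) has_real_derivative 0) (at x) =
        ((\<lambda>_. 0) has_real_derivative 0) (at x)"
      by (intro DERIV_cong_ev) auto
    then show ?thesis using 1 by (simp add: max_def)
  next
    case 2
    have "\<forall>\<^sub>F y in nhds x. max (y - a) 0 ^ Suc (Suc n) = (y - a) ^ Suc (Suc n)"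
      using eventually_nhds_in_open[of "{a<..}" x] 2 by (auto elim!: eventually_mono simp: max_def)
    then have "((\<lambda>x. max (x - a) 0 ^ Suc (Suc n)) has_real_derivative D) (at x) =
        ((\<lambda>x. (x - a) ^ Suc (Suc n)) has_real_derivative D) (at x)" for D
      by (intro DERIV_cong_ev) auto
    moreover have "((\<lambda>x. x - a) has_real_derivative 1) (at x)"
      by (auto intro!: derivative_eq_intros)
    from DERIV_power[OF this, of "Suc (Suc n)"]
    have "((\<lambda>x. (x - a) ^ Suc (Suc n)) has_real_derivative real (Suc (Suc n)) * (x - a) ^ Suc n) (at x)"
      by (simp del: power_Suc of_nat_Suc)
    ultimately show ?thesis using 2 by (simp add: max_def)
  next
    case 3
    have "((\<lambda>h. max h 0 ^ Suc n) \<longlongrightarrow> max 0 0 ^ Suc n) (at (0::real))"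
      by (intro tendsto_intros)
    then have "((\<lambda>h. max h 0 ^ Suc n) \<longlongrightarrow> 0) (at (0::real))" by simp
    then have "((\<lambda>h. max h 0 ^ Suc (Suc n) / h) \<longlongrightarrow> 0) (at (0::real))"
      by (rule Lim_transform_eventually) (auto simp: eventually_at_filter max_def)
    then show ?thesis using 3 by (simp add: DERIV_def)
  qed
qed

lemma green_has_derivative:
  assumes "k < 2"
  shows "(green a k has_real_derivative green a (Suc k) x) (at x within S)"
proof -
  consider "k = 0" | "k = 1" using assms by linarith
  then show ?thesis
  proof cases
    case 1
    have "((\<lambda>x. max (x - a) 0 ^ 3 / 6 - x ^ 3 / 6 + (1 - (1 - a)\<^sup>2) / 2 * x) has_real_derivative
        3 * (max (x - a) 0)\<^sup>2 / 6 - 3 * x\<^sup>2 / 6 + (1 - (1 - a)\<^sup>2) / 2 * 1) (at x within S)"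
      using truncated_power_has_derivative[of a 1 x S] DERIV_pow[of 3 x S]
      by (intro DERIV_add DERIV_diff DERIV_cdivide DERIV_cmult DERIV_ident) (simp_all add: eval_nat_numeral)
    then show ?thesis using 1 by (simp add: green_def[abs_def])
  next
    case 2
    have "((\<lambda>x. (max (x - a) 0)\<^sup>2 / 2 - x\<^sup>2 / 2 + (1 - (1 - a)\<^sup>2) / 2) has_real_derivative
        2 * max (x - a) 0 / 2 - 2 * x / 2 + 0) (at x within S)"
      using truncated_power_has_derivative[of a 0 x S] DERIV_pow[of 2 x S]
      by (intro DERIV_add DERIV_diff DERIV_cdivide DERIV_const) (simp_all add: eval_nat_numeral)
    then show ?thesis using 2 by (simp add: green_def[abs_def])
  qed
qed

lemma green_continuous_on: "continuous_on S (green a k)"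
  unfolding green_def[abs_def] by (cases "k = 0"; cases "k = 1") (auto intro!: continuous_intros)

text \<open>Two integrations by parts move derivatives onto \<open>green\<close>. The resulting
  factor -min x a is only piecewise linear, so the remaining integral is split at \<open>a\<close>
  and evaluated with explicit primitives.\<close>

lemma green_weak_solution:
  assumes a: "0 < a" "a < 1" and \<theta>: "test_function \<theta>"
  shows "integral {0..1} (\<lambda>x. green a 0 x * (deriv ^^ 4) \<theta> x) = \<theta> a"
proof -
  define \<theta>1 where "\<theta>1 = (deriv ^^ 1) \<theta>"
  define \<theta>2 where "\<theta>2 = (deriv ^^ 2) \<theta>"
  have D: "(\<theta> has_real_derivative \<theta>1 x) (at x within S)" "(\<theta>1 has_real_derivative \<theta>2 x) (at x within S)" for x S
    using test_function_has_derivative[OF \<theta>, of 0 x S] test_function_has_derivative[OF \<theta>, of 1 x S]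
    by (simp_all add: \<theta>1_def \<theta>2_def numeral_2_eq_2)
  have "integral {0..1} (\<lambda>x. green a 0 x * (deriv ^^ 4) \<theta> x) =
      - integral {0..1} (\<lambda>x. green a (Suc 0) x * (deriv ^^ 3) \<theta> x)"
    using test_function_by_parts[OF \<theta> green_has_derivative green_continuous_on, of 0 a 3] by simp
  also have "\<dots> = integral {0..1} (\<lambda>x. green a 2 x * \<theta>2 x)"
    using test_function_by_parts[OF \<theta> green_has_derivative green_continuous_on, of 1 a 2]
    by (simp add: \<theta>2_def numeral_2_eq_2 numeral_3_eq_3)
  also have "\<dots> = \<theta> a"
  proof (rule integral_unique)
    \<comment> \<open>On [0,a] the primitive of \<open>- (x * \<theta>2 x)\<close> is
      \<open>\<theta> x - x * \<theta>1 x\<close>; on [a,1] that of \<open>- a * \<theta>2 x\<close>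
      is \<open>- a * \<theta>1 x\<close>. The contributions of \<open>\<theta>1 a\<close> cancel
      and \<open>\<theta> a\<close> remains.\<close>
    have "((\<lambda>x. - (x * \<theta>2 x)) has_integral (\<theta> a - a * \<theta>1 a) - (\<theta> 0 - 0 * \<theta>1 0)) {0..a}"
    proof (rule fundamental_theorem_of_calculus)
      fix x
      have "((\<lambda>x. \<theta> x - x * \<theta>1 x) has_real_derivative \<theta>1 x - (1 * \<theta>1 x + \<theta>2 x * x)) (at x within {0..a})"
        by (intro DERIV_diff DERIV_mult DERIV_ident D)
      then show "((\<lambda>x. \<theta> x - x * \<theta>1 x) has_vector_derivative - (x * \<theta>2 x)) (at x within {0..a})"
        by (simp add: has_real_derivative_iff_has_vector_derivative mult.commute)
    qed (use a in simp)
    then have l: "((\<lambda>x. green a 2 x * \<theta>2 x) has_integral \<theta> a - a * \<theta>1 a - \<theta> 0) {0..a}"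
      using has_integral_cong[of "{0..a}" "\<lambda>x. green a 2 x * \<theta>2 x" "\<lambda>x. - (x * \<theta>2 x)"]
      by (simp add: green_def max_def)
    have "((\<lambda>x. - a * \<theta>2 x) has_integral (- a * \<theta>1 1) - (- a * \<theta>1 a)) {a..1}"
    proof (rule fundamental_theorem_of_calculus)
      fix x
      show "((\<lambda>x. - a * \<theta>1 x) has_vector_derivative - a * \<theta>2 x) (at x within {a..1})"
        unfolding has_real_derivative_iff_has_vector_derivative[symmetric]
        by (intro DERIV_cmult D)
    qed (use a in simp)
    then have r: "((\<lambda>x. green a 2 x * \<theta>2 x) has_integral (- a * \<theta>1 1) - (- a * \<theta>1 a)) {a..1}"
      using has_integral_cong[of "{a..1}" "\<lambda>x. green a 2 x * \<theta>2 x" "\<lambda>x. - a * \<theta>2 x"]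
      by (simp add: green_def max_def)
    have "((\<lambda>x. green a 2 x * \<theta>2 x) has_integral
        (\<theta> a - a * \<theta>1 a - \<theta> 0) + ((- a * \<theta>1 1) - (- a * \<theta>1 a))) {0..1}"
      by (rule has_integral_combine[OF _ _ l r]) (use a in auto)
    moreover have "\<theta> 0 = 0" "\<theta>1 1 = 0"
      using test_function_outside[OF \<theta>, of 0 0] test_function_outside[OF \<theta>, of 1 1] by (simp_all add: \<theta>1_def)
    ultimately show "((\<lambda>x. green a 2 x * \<theta>2 x) has_integral \<theta> a) {0..1}" by simp
  qed
  finally show ?thesis .
qed

text \<open>The difference from the Green function is a cubic. The boundary conditions remove its
  coefficients from the top down: the third derivative at 1, the second at 0, the first at 1, the
  value at 0.\<close>

lemma pointwise_steady_state_eq: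
  assumes a: "0 < a" "a < 1" and w: "pointwise_steady_state a \<alpha> w" and "x \<in> {0..1}"
  shows "w x = \<alpha> * green a 0 x"
proof -
  have cont: "continuous_on {0..1} w" and boundary: "beam_boundary w 0"
    and weak: "\<And>\<theta>. test_function \<theta> \<Longrightarrow> integral {0..1} (\<lambda>x. w x * (deriv ^^ 4) \<theta> x) = \<alpha> * \<theta> a"
    using w by (auto simp: pointwise_steady_state_def)
  have "\<exists>c. \<forall>x\<in>{0..1}. w x - \<alpha> * green a 0 x = (\<Sum>i<4. c i * x ^ i)"
  proof (rule weak_polynomial)
    show "continuous_on {0..1} (\<lambda>x. w x - \<alpha> * green a 0 x)"
      by (intro continuous_intros cont green_continuous_on)
    fix \<theta> assume \<theta>: "test_function \<theta>"
    have int: "(\<lambda>x. u x * (deriv ^^ 4) \<theta> x) integrable_on {0..1}" if "continuous_on {0..1} u" for u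
      by (intro integrable_continuous_real continuous_on_mult that test_function_continuous_on[OF \<theta>])
    have "(\<lambda>x. (w x - \<alpha> * green a 0 x) * (deriv ^^ 4) \<theta> x) =
        (\<lambda>x. w x * (deriv ^^ 4) \<theta> x - \<alpha> * (green a 0 x * (deriv ^^ 4) \<theta> x))"
      by (rule ext) (simp add: left_diff_distrib)
    then have "integral {0..1} (\<lambda>x. (w x - \<alpha> * green a 0 x) * (deriv ^^ 4) \<theta> x) =
        integral {0..1} (\<lambda>x. w x * (deriv ^^ 4) \<theta> x) -
        integral {0..1} (\<lambda>x. \<alpha> * (green a 0 x * (deriv ^^ 4) \<theta> x))"
      using Henstock_Kurzweil_Integration.integral_diff[OF int[OF cont]
          integrable_on_mult_right[OF int[OF green_continuous_on]], of \<alpha> a 0]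
      by (simp only:)
    also have "\<dots> = 0"
      by (simp only: weak[OF \<theta>] integral_mult_right green_weak_solution[OF a \<theta>] diff_self)
    finally show "integral {0..1} (\<lambda>x. (w x - \<alpha> * green a 0 x) * (deriv ^^ 4) \<theta> x) = 0" .
  qed
  then obtain c where c: "\<And>x. x \<in> {0..1} \<Longrightarrow> w x - \<alpha> * green a 0 x = (\<Sum>i<4. c i * x ^ i)" by blast
  \<comment> \<open>For \<open>k\<close> up to 2, \<open>P k\<close> is the k-th derivative of the
    cubic and \<open>W k\<close> that of \<open>w\<close> on [0,1].\<close>
  define P where "P k x = (if k = 0 then c 0 + c 1 * x + c 2 * x ^ 2 + c 3 * x ^ 3
      else if k = 1 then c 1 + 2 * c 2 * x + 3 * c 3 * x\<^sup>2 else 2 * c 2 + 6 * c 3 * x)"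
    for k :: nat and x :: real
  define W where "W k x = \<alpha> * green a k x + P k x" for k x
  have w_eq: "w y = W 0 y" if "y \<in> {0..1}" for y
    using c[OF that] by (simp add: W_def P_def eval_nat_numeral algebra_simps)
  have P: "(P k has_real_derivative P (Suc k) y) (at y within S)" if k: "k < 2" for k y S
  proof -
    consider "k = 0" | "k = 1" using k by linarith
    then show ?thesis
      by cases (auto simp: P_def[abs_def] power2_eq_square power3_eq_cube algebra_simps intro!: derivative_eq_intros)
  qed
  have W: "(W k has_real_derivative W (Suc k) y) (at y within S)" if "k < 2" for k y S
    unfolding W_def by (intro DERIV_add DERIV_cmult green_has_derivative P that)
  \<comment> \<open>Since \<open>a < 1\<close>, the bending moment \<open>green a 2\<close> is
    constantly \<open>- a\<close> near 1, so only the cubic contributes to the third derivative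
    there.\<close>
  have W2: "(W 2 has_real_derivative 6 * c 3) (at 1 within {0..1})"
  proof (rule has_field_derivative_at_within)
    have "\<forall>\<^sub>F y in nhds 1. W 2 y = \<alpha> * (- a) + (2 * c 2 + 6 * c 3 * y)"
      using eventually_nhds_in_open[of "{a<..}" 1] a
      by (auto elim!: eventually_mono simp: W_def P_def green_def max_def)
    then have "(W 2 has_real_derivative 6 * c 3) (at 1) =
        ((\<lambda>y. \<alpha> * (- a) + (2 * c 2 + 6 * c 3 * y)) has_real_derivative 6 * c 3) (at 1)"
      by (intro DERIV_cong_ev) auto
    then show "(W 2 has_real_derivative 6 * c 3) (at 1)" by (auto intro!: derivative_eq_intros)
  qed
  have B: "has_nth_derivative {0..1} 1 w 0 1" "has_nth_derivative {0..1} 2 w 0 0"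
    "has_nth_derivative {0..1} 3 w 0 1" "w 0 = 0"
    using boundary unfolding beam_boundary_def by blast+
  have "has_nth_derivative {0..1} (Suc 0) w (W 1 1) 1"
    by (rule has_nth_derivative_SucI[where D = W]) (use w_eq W[of 0] in auto)
  then have b1: "W 1 1 = 0"
    unfolding One_nat_def[symmetric] by (rule has_nth_derivative_unique[OF _ B(1)]) simp
  have "has_nth_derivative {0..1} (Suc 1) w (W 2 0) 0"
    by (rule has_nth_derivative_SucI[where D = W]) (use w_eq W W[of 1] in \<open>auto simp: numeral_2_eq_2\<close>)
  then have b2: "W 2 0 = 0"
    unfolding Suc_1 by (rule has_nth_derivative_unique[OF _ B(2)]) simp
  have "has_nth_derivative {0..1} (Suc 2) w (6 * c 3) 1"
    by (rule has_nth_derivative_SucI[where D = W]) (use w_eq W W2 in auto)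
  moreover have "Suc 2 = 3" by simp
  ultimately have "has_nth_derivative {0..1} 3 w (6 * c 3) 1" by (simp only:)
  then have b3: "6 * c 3 = 0" by (rule has_nth_derivative_unique[OF _ B(3)]) simp
  have b0: "W 0 0 = 0" using B(4) w_eq[of 0] by simp
  have c3: "c 3 = 0" using b3 by simp
  have c2: "c 2 = 0" using b2 a by (simp add: W_def P_def green_def)
  have c1: "c 1 = 0" using b1 c2 c3 a by (simp add: W_def P_def green_def field_simps)
  have c0: "c 0 = 0" using b0 a by (simp add: W_def P_def green_def)
  show ?thesis using w_eq[OF \<open>x \<in> {0..1}\<close>] c0 c1 c2 c3 by (simp add: W_def P_def)
qed

subsection \<open>Convergence of the regularized steady states\<close>

text \<open>By the mean value inequality, a difference that vanishes at \<open>c\<close> is bounded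
  on an interval of length 1 by the supremum of its derivative.\<close>

lemma uniform_limit_antiderivative:
  assumes "\<forall>\<^sub>F n in F. f n c = 0 \<and> (\<forall>x\<in>{0..1}. (f n has_real_derivative f' n x) (at x within {0..1}))"
    and "g c = 0" "\<And>x. x \<in> {0..1} \<Longrightarrow> (g has_real_derivative g' x) (at x within {0..1})"
    and "c \<in> {0..1}" and lim: "uniform_limit {0..1} f' g' F"
  shows "uniform_limit {0..1} f g F"
  unfolding uniform_limit_iff
proof (intro allI impI)
  fix e :: real assume "e > 0"
  then have "\<forall>\<^sub>F n in F. \<forall>x\<in>{0..1}. dist (f' n x) (g' x) < e / 2"
    using lim half_gt_zero unfolding uniform_limit_iff by blast
  with assms(1) show "\<forall>\<^sub>F n in F. \<forall>x\<in>{0..1}. dist (f n x) (g x) < e"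
  proof eventually_elim
    case (elim n)
    show ?case
    proof
      fix x :: real assume x: "x \<in> {0..1}"
      have "norm ((f n x - g x) - (f n c - g c)) \<le> e / 2 * norm (x - c)"
      proof (rule field_differentiable_bound[where S = "{0..1}"])
        fix z :: real assume "z \<in> {0..1}"
        then show "((\<lambda>x. f n x - g x) has_real_derivative f' n z - g' z) (at z within {0..1})"
          using elim assms(3) by (intro DERIV_diff) auto
        show "norm (f' n z - g' z) \<le> e / 2"
          using elim \<open>z \<in> {0..1}\<close> by (auto simp: dist_norm intro: less_imp_le)
      qed (use x assms(4) in auto)
      also have "\<dots> \<le> e / 2 * 1"
        using x assms(4) \<open>e > 0\<close> by (intro mult_left_mono) (auto simp: abs_le_iff)
      finally show "dist (f n x) (g x) < e"
        using elim assms(2) \<open>e > 0\<close> by (simp add: dist_norm)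
    qed
  qed
qed

lemma antiderivative_unique:
  fixes f g :: "real \<Rightarrow> real"
  assumes "\<And>x. x \<in> {0..1} \<Longrightarrow> (f has_real_derivative h x) (at x within {0..1})"
    and "\<And>x. x \<in> {0..1} \<Longrightarrow> (g has_real_derivative h x) (at x within {0..1})"
    and "f c = g c" "c \<in> {0..1}" "x \<in> {0..1}"
  shows "f x = g x"
proof -
  have "norm ((f x - g x) - (f c - g c)) \<le> 0 * norm (x - c)"
  proof (rule field_differentiable_bound[where S = "{0..1}"])
    fix z :: real assume "z \<in> {0..1}"
    from DERIV_diff[OF assms(1,2)[OF this]]
    show "((\<lambda>x. f x - g x) has_real_derivative h z - h z) (at z within {0..1})" .
  qed (use assms(4,5) in auto)
  then show ?thesis using assms(3) by simp
qed

section \<open>The sine integral and its primitive at large scales\<close>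

definition Si_primitive :: "real \<Rightarrow> real" where
  "Si_primitive t = t * Si t + cos t"

lemma Si_minus: "Si (- t) = - Si t"
  using Si_neg[of t] Si_neg[of "- t"] by (cases "t \<ge> 0") auto

lemma Si_primitive_minus [simp]: "Si_primitive (- t) = Si_primitive t"
  by (simp add: Si_primitive_def Si_minus)

text \<open>The product rule leaves t sinc t = sin t, which cancels the derivative of the
  cosine.\<close>

lemma Si_primitive_has_derivative: "(Si_primitive has_real_derivative Si t) (at t)"
proof -
  have "((\<lambda>t. t * Si t + cos t) has_real_derivative (1 * Si t + sinc t * t) + - sin t) (at t)"
    by (intro DERIV_add DERIV_mult DERIV_ident DERIV_Si DERIV_cos)
  moreover have "(1 * Si t + sinc t * t) + - sin t = Si t" by simp
  ultimately show ?thesis by (simp add: Si_primitive_def[abs_def] del: mult_1)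
qed

text \<open>An arbitrarily small slope plus a constant is the form that survives rescaling: with t =
  m z and division by m it becomes e \<bar>z\<bar> + C/m, uniformly in z, including z near
  0.\<close>

lemma Si_primitive_asymp:
  assumes "e > 0"
  obtains C where "\<And>t. \<bar>Si_primitive t - pi / 2 * \<bar>t\<bar>\<bar> \<le> e * \<bar>t\<bar> + C"
proof -
  obtain B where B: "\<And>t. \<bar>Si t\<bar> \<le> B" using bounded_Si by blast
  have "\<forall>\<^sub>F t in at_top. dist (Si t) (pi / 2) < e" using Si_at_top assms by (rule tendstoD)
  then obtain T0 where T0: "\<And>t. t \<ge> T0 \<Longrightarrow> \<bar>Si t - pi / 2\<bar> < e"
    by (auto simp: eventually_at_top_linorder dist_real_def)
  \<comment> \<open>Beyond \<open>T0\<close> the deviation of \<open>Si\<close> from its limit is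
    below \<open>e\<close>; before it, the deviation is at most \<open>B + pi / 2\<close>, which
    costs \<open>T * (B + pi / 2)\<close>. The further 1 bounds the cosine, and the maximum with 0
    keeps the constant nonnegative.\<close>
  define T where "T = max T0 0"
  have nonneg: "\<bar>Si_primitive t - pi / 2 * \<bar>t\<bar>\<bar> \<le> e * \<bar>t\<bar> + (T * (B + pi / 2) + 1)" if t: "t \<ge> 0" for t
  proof -
    have "B \<ge> 0" using B[of 0] by linarith
    have "\<bar>Si_primitive t - pi / 2 * \<bar>t\<bar>\<bar> = \<bar>t * (Si t - pi / 2) + cos t\<bar>"
      using t by (simp add: Si_primitive_def algebra_simps)
    also have "\<dots> \<le> \<bar>t * (Si t - pi / 2)\<bar> + \<bar>cos t\<bar>" by (rule abs_triangle_ineq)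
    also have "\<dots> \<le> t * \<bar>Si t - pi / 2\<bar> + 1"
      using t abs_cos_le_one[of t] by (simp add: abs_mult)
    also have "t * \<bar>Si t - pi / 2\<bar> \<le> e * t + T * (B + pi / 2)"
    proof (cases "t \<ge> T0")
      case True
      have "t * \<bar>Si t - pi / 2\<bar> \<le> t * e" using T0[OF True] t by (intro mult_left_mono) auto
      moreover have "0 \<le> T * (B + pi / 2)" using \<open>B \<ge> 0\<close> by (simp add: T_def)
      ultimately show ?thesis by (simp add: mult.commute)
    next
      case False
      have "\<bar>Si t - pi / 2\<bar> \<le> B + pi / 2" using B[of t] pi_gt_zero by linarith
      then have "t * \<bar>Si t - pi / 2\<bar> \<le> T * (B + pi / 2)"
        using False t by (intro mult_mono) (auto simp: T_def)
      moreover have "0 \<le> e * t" using assms t by simp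
      ultimately show ?thesis by linarith
    qed
    finally show ?thesis using t by simp
  qed
  have "\<bar>Si_primitive t - pi / 2 * \<bar>t\<bar>\<bar> \<le> e * \<bar>t\<bar> + (T * (B + pi / 2) + 1)" for t
    using nonneg[of t] nonneg[of "- t"] by (cases "t \<ge> 0") auto
  then show thesis by (rule that)
qed

lemma uniform_limit_Si_primitive:
  "uniform_limit {-1..1} (\<lambda>m z. Si_primitive (m * z) / m) (\<lambda>z. pi / 2 * \<bar>z\<bar>) at_top"
  unfolding uniform_limit_iff
proof (intro allI impI)
  fix e :: real assume e: "e > 0"
  obtain C where C: "\<And>t. \<bar>Si_primitive t - pi / 2 * \<bar>t\<bar>\<bar> \<le> e / 2 * \<bar>t\<bar> + C"
    using Si_primitive_asymp[of "e / 2"] e by auto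
  \<comment> \<open>The threshold \<open>2 * C / e\<close> makes \<open>C / m\<close> less than
    \<open>e / 2\<close>; the other half of \<open>e\<close> pays for the slope.\<close>
  show "\<forall>\<^sub>F m in at_top. \<forall>z\<in>{-1..1}. dist (Si_primitive (m * z) / m) (pi / 2 * \<bar>z\<bar>) < e"
    using eventually_gt_at_top[of 0] eventually_gt_at_top[of "2 * C / e"]
  proof eventually_elim
    case (elim m)
    show ?case
    proof
      fix z :: real assume "z \<in> {-1..1}"
      then have "\<bar>z\<bar> \<le> 1" by auto
      have "dist (Si_primitive (m * z) / m) (pi / 2 * \<bar>z\<bar>) = \<bar>Si_primitive (m * z) / m - pi / 2 * \<bar>z\<bar>\<bar>"
        by (rule dist_real_def)
      also have "\<dots> = \<bar>(Si_primitive (m * z) - pi / 2 * \<bar>m * z\<bar>) / m\<bar>"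
        using elim by (simp add: diff_divide_distrib abs_mult)
      also have "\<dots> = \<bar>Si_primitive (m * z) - pi / 2 * \<bar>m * z\<bar>\<bar> / m" using elim by simp
      also have "\<dots> \<le> (e / 2 * \<bar>m * z\<bar> + C) / m"
        using elim C by (intro divide_right_mono) auto
      also have "\<dots> = e / 2 * \<bar>z\<bar> + C / m" using elim by (simp add: abs_mult field_simps)
      also have "\<dots> \<le> e / 2 * 1 + C / m" using \<open>\<bar>z\<bar> \<le> 1\<close> e by (intro add_right_mono mult_left_mono) auto
      also have "C / m < e / 2" using elim e by (simp add: field_simps)
      finally show "dist (Si_primitive (m * z) / m) (pi / 2 * \<bar>z\<bar>) < e" by simp
    qed
  qed
qed

text \<open>The second derivative of the regularized steady state for unit load.\<close>

definition regularized_moment :: "real \<Rightarrow> real \<Rightarrow> real \<Rightarrow> real" where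
  "regularized_moment a m x =
    (Si_primitive (m * (x - a)) / m - Si_primitive (m * a) / m - x * Si (m * (1 - a))) / pi"

text \<open>The three terms converge to give (\<bar>x - a\<bar> - a - x)/2, which is
  \<open>max (x - a) 0 - x\<close>. The Si term needs \<open>a < 1\<close>, so that its argument
  tends to infinity.\<close>

lemma uniform_limit_regularized_moment:
  assumes "0 < a" "a < 1"
  shows "uniform_limit {0..1} (regularized_moment a) (green a 2) at_top"
proof -
  \<comment> \<open>Used for \<open>x - a\<close> and for the constant \<open>a\<close>, both with
    values in [-1,1].\<close>
  have comp: "uniform_limit {0..1} (\<lambda>m x. Si_primitive (m * h x) / m) (\<lambda>x. pi / 2 * \<bar>h x\<bar>) at_top"
    if "\<And>x. x \<in> {0..1} \<Longrightarrow> h x \<in> {-1..1}" for h :: "real \<Rightarrow> real"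
    unfolding uniform_limit_iff
  proof (intro allI impI)
    fix e :: real assume "e > 0"
    then have "\<forall>\<^sub>F m in at_top. \<forall>z\<in>{-1..1}. dist (Si_primitive (m * z) / m) (pi / 2 * \<bar>z\<bar>) < e"
      using uniform_limit_Si_primitive unfolding uniform_limit_iff by blast
    then show "\<forall>\<^sub>F m in at_top. \<forall>x\<in>{0..1}. dist (Si_primitive (m * h x) / m) (pi / 2 * \<bar>h x\<bar>) < e"
      by eventually_elim (use that in blast)
  qed
  have "filterlim (\<lambda>m. m * (1 - a)) at_top at_top"
    using filterlim_tendsto_pos_mult_at_top[OF tendsto_const[of "1 - a"] _ filterlim_ident] assms
    by (simp add: mult.commute)
  then have "((\<lambda>m. Si (m * (1 - a))) \<longlongrightarrow> pi / 2) at_top"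
    by (rule filterlim_compose[OF Si_at_top])
  then have Si: "uniform_limit {0..1} (\<lambda>m x. x * Si (m * (1 - a))) (\<lambda>x. x * (pi / 2)) at_top"
    unfolding uniform_limit_iff tendsto_iff
  proof (intro allI impI)
    fix e :: real
    assume "\<forall>e>0. \<forall>\<^sub>F m in at_top. dist (Si (m * (1 - a))) (pi / 2) < e" "e > 0"
    then have "\<forall>\<^sub>F m in at_top. dist (Si (m * (1 - a))) (pi / 2) < e" by blast
    then show "\<forall>\<^sub>F m in at_top. \<forall>x\<in>{0..1}. dist (x * Si (m * (1 - a))) (x * (pi / 2)) < e"
    proof eventually_elim
      case (elim m)
      show ?case
      proof
        fix x :: real assume x: "x \<in> {0..1}"
        have "dist (x * Si (m * (1 - a))) (x * (pi / 2)) = x * dist (Si (m * (1 - a))) (pi / 2)"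
          unfolding dist_real_def right_diff_distrib[symmetric] abs_mult using x by simp
        also have "\<dots> \<le> 1 * dist (Si (m * (1 - a))) (pi / 2)" using x by (intro mult_right_mono) auto
        finally show "dist (x * Si (m * (1 - a))) (x * (pi / 2)) < e" using elim by simp
      qed
    qed
  qed
  have "uniform_limit {0..1} (\<lambda>m x. (Si_primitive (m * (x - a)) / m - Si_primitive (m * a) / m - x * Si (m * (1 - a))) / pi)
      (\<lambda>x. (pi / 2 * \<bar>x - a\<bar> - pi / 2 * \<bar>a\<bar> - x * (pi / 2)) / pi) at_top"
    by (intro bounded_linear.uniform_limit[OF bounded_linear_divide] uniform_limit_minus comp Si)
      (use assms in auto)
  moreover have "(pi / 2 * \<bar>x - a\<bar> - pi / 2 * \<bar>a\<bar> - x * (pi / 2)) / pi = green a 2 x" for x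
    using assms by (simp add: green_def field_simps max_def abs_if)
  ultimately show ?thesis by (simp add: regularized_moment_def[abs_def])
qed

text \<open>The kernel is a rescaled \<open>sinc\<close>, so its primitives are explicit. The
  condition at 1 fixes the constant \<open>Si (m * (1 - a))\<close>; the one at 0 fixes
  \<open>Si_primitive (m * a) / m\<close>, by evenness of \<open>Si_primitive\<close>.\<close>

lemma regularized_moment_eq:
  assumes "m > 0"
    and f2: "\<And>x. x \<in> {0..1} \<Longrightarrow> (f2 has_real_derivative f3 x) (at x within {0..1})"
    and f3: "\<And>x. x \<in> {0..1} \<Longrightarrow> (f3 has_real_derivative \<alpha> * phi m (x - a)) (at x within {0..1})"
    and "f2 0 = 0" "f3 1 = 0" "x \<in> {0..1}"
  shows "f2 x = \<alpha> * regularized_moment a m x"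
proof -
  have chain: "((\<lambda>x. F (m * (x - a))) has_real_derivative F' (m * (x - a)) * m) (at x within S)"
    if "\<And>t. (F has_real_derivative F' t) (at t)" for F F' x S
    by (rule DERIV_chain'[OF _ that]) (auto intro!: derivative_eq_intros)
  have f3_eq: "f3 y = \<alpha> * ((Si (m * (y - a)) - Si (m * (1 - a))) / pi)" if y: "y \<in> {0..1}" for y
  proof (rule antiderivative_unique[OF f3 _ _ _ y, where c = 1])
    fix x
    have "((\<lambda>x. \<alpha> * ((Si (m * (x - a)) - Si (m * (1 - a))) / pi)) has_real_derivative
        \<alpha> * ((sinc (m * (x - a)) * m - 0) / pi)) (at x within {0..1})"
      by (intro DERIV_cmult DERIV_cdivide DERIV_diff DERIV_const chain DERIV_Si)
    \<comment> \<open>At the load point both sides equal \<open>m / pi\<close>, the value put into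
      \<open>phi\<close> at 0 by continuity.\<close>
    moreover have "(sinc (m * (x - a)) * m - 0) / pi = phi m (x - a)"
      using \<open>m > 0\<close> by (auto simp: phi_def)
    ultimately show "((\<lambda>x. \<alpha> * ((Si (m * (x - a)) - Si (m * (1 - a))) / pi)) has_real_derivative
        \<alpha> * phi m (x - a)) (at x within {0..1})" by (simp only:)
  qed (use \<open>f3 1 = 0\<close> in auto)
  show ?thesis
  proof (rule antiderivative_unique[OF f2 _ _ _ \<open>x \<in> {0..1}\<close>, where c = 0])
    fix x :: real assume x: "x \<in> {0..1}"
    have "((\<lambda>x. \<alpha> * regularized_moment a m x) has_real_derivative
        \<alpha> * ((Si (m * (x - a)) * m / m - 0 - 1 * Si (m * (1 - a))) / pi)) (at x within {0..1})"
      unfolding regularized_moment_def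
      by (intro DERIV_cmult DERIV_cdivide DERIV_diff DERIV_const DERIV_cmult_right DERIV_ident
          chain Si_primitive_has_derivative)
    then show "((\<lambda>x. \<alpha> * regularized_moment a m x) has_real_derivative f3 x) (at x within {0..1})"
      using \<open>m > 0\<close> by (simp add: f3_eq[OF x])
  qed (use \<open>f2 0 = 0\<close> in \<open>auto simp: regularized_moment_def\<close>)
qed

section \<open>Passage to the limit in C^1\<close>

lemma regularized_steady_state_derivatives:
  assumes m: "m > 0" and H: "lifting_function m a H" and \<psi>: "regularized_steady_state H g \<psi>"
  shows "\<exists>\<psi>'. \<psi> 0 = 0 \<and> \<psi>' 1 = 0 \<and>
      (\<forall>x\<in>{0..1}. (\<psi> has_real_derivative \<psi>' x) (at x within {0..1}) \<and>
        (\<psi>' has_real_derivative - g * regularized_moment a m x) (at x within {0..1}))"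
proof -
  have d: "\<forall>x\<in>{0..1}. has_nth_derivative {0..1} 4 \<psi> (- g * phi m (x - a)) x"
  proof
    fix x :: real assume x: "x \<in> {0..1}"
    obtain h where h: "has_nth_derivative {0..1} 4 H h x" "has_nth_derivative {0..1} 4 \<psi> (- g * h) x"
      using \<psi> x unfolding regularized_steady_state_def by blast
    have "has_nth_derivative {0..1} 4 H (phi m (x - a)) x"
      using H x unfolding lifting_function_def by blast
    \<comment> \<open>The lifting function enters only through its fourth derivative; uniqueness
      identifies that with the kernel.\<close>
    then have "phi m (x - a) = h" by (rule has_nth_derivative_unique[OF _ h(1) x])
    with h(2) show "has_nth_derivative {0..1} 4 \<psi> (- g * phi m (x - a)) x" by (simp only:)
  qed
  have "beam_boundary \<psi> 0" using \<psi> by (simp add: regularized_steady_state_def)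
  from has_nth_derivative_4_chain[OF d this] obtain f1 f2 f3
    where f: "\<psi> 0 = 0" "f1 1 = 0" "f2 0 = 0" "f3 1 = 0"
      "\<forall>x\<in>{0..1}. (\<psi> has_real_derivative f1 x) (at x within {0..1}) \<and>
        (f1 has_real_derivative f2 x) (at x within {0..1}) \<and>
        (f2 has_real_derivative f3 x) (at x within {0..1}) \<and>
        (f3 has_real_derivative - g * phi m (x - a)) (at x within {0..1})"
    by (elim exE conjE)
  have "(f1 has_real_derivative - g * regularized_moment a m x) (at x within {0..1})"
    if "x \<in> {0..1}" for x
  proof -
    have eq: "f2 x = - g * regularized_moment a m x"
      by (rule regularized_moment_eq[of m f2 f3 "- g" a x, OF m _ _ f(3,4) that]) (use f(5) in simp_all)
    have "(f1 has_real_derivative f2 x) (at x within {0..1})" using f(5) that by blast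
    then show ?thesis unfolding eq .
  qed
  with f(1,2,5) show ?thesis by (intro exI[of _ f1] conjI ballI) simp_all
qed

text \<open>Uniform convergence of the second derivatives is integrated from 1, where the slopes
  vanish, and then from 0, where the functions vanish.\<close>

lemma regularized_steady_state_convergence:
  assumes a: "0 < a" "a < 1"
    and H: "\<And>m. m > 0 \<Longrightarrow> lifting_function m a (H m)"
    and \<psi>: "\<And>m. m > 0 \<Longrightarrow> regularized_steady_state (H m) g (\<psi> m)"
    and w: "pointwise_steady_state a (- g) w"
  shows "C1_convergence {0..1} \<psi> w at_top"
proof -
  \<comment> \<open>The derivatives are selected for positive \<open>m\<close> only, where the
    equations hold; the filter at infinity sees nothing else.\<close>
  have "\<forall>m\<in>{0<..}. \<exists>\<psi>'. \<psi> m 0 = 0 \<and> \<psi>' 1 = 0 \<and>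
      (\<forall>x\<in>{0..1}. (\<psi> m has_real_derivative \<psi>' x) (at x within {0..1}) \<and>
        (\<psi>' has_real_derivative - g * regularized_moment a m x) (at x within {0..1}))"
    using regularized_steady_state_derivatives[OF _ H \<psi>] by blast
  then obtain \<psi>' where "\<forall>m\<in>{0<..}. \<psi> m 0 = 0 \<and> \<psi>' m 1 = 0 \<and>
      (\<forall>x\<in>{0..1}. (\<psi> m has_real_derivative \<psi>' m x) (at x within {0..1}) \<and>
        (\<psi>' m has_real_derivative - g * regularized_moment a m x) (at x within {0..1}))"
    unfolding bchoice_iff by blast
  then have \<psi>': "\<psi> m 0 = 0" "\<psi>' m 1 = 0"
    "\<And>x. x \<in> {0..1} \<Longrightarrow> (\<psi> m has_real_derivative \<psi>' m x) (at x within {0..1})"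
    "\<And>x. x \<in> {0..1} \<Longrightarrow> (\<psi>' m has_real_derivative - g * regularized_moment a m x) (at x within {0..1})"
    if "m > 0" for m
    using that unfolding greaterThan_iff by blast+
  note pos = eventually_gt_at_top[of "0::real"]
  let ?w = "\<lambda>k x. - g * green a k x"
  have D: "(?w k has_real_derivative ?w (Suc k) x) (at x within {0..1})" if "k < 2" for k x
    by (intro DERIV_cmult green_has_derivative that)
  have lim2: "uniform_limit {0..1} (\<lambda>m x. - g * regularized_moment a m x) (?w 2) at_top"
    by (intro bounded_linear.uniform_limit[OF bounded_linear_mult_right] uniform_limit_regularized_moment a)
  have lim1: "uniform_limit {0..1} \<psi>' (?w 1) at_top"
  proof (rule uniform_limit_antiderivative[OF _ _ _ _ lim2, where c = 1])
    show "\<forall>\<^sub>F m in at_top. \<psi>' m 1 = 0 \<and> (\<forall>x\<in>{0..1}. (\<psi>' m has_real_derivative - g * regularized_moment a m x) (at x within {0..1}))"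
      using pos
    proof eventually_elim
      case (elim m)
      then show ?case using \<psi>' by blast
    qed
    \<comment> \<open>The linear coefficient \<open>(1 - (1 - a)\<^sup>2) / 2\<close> in
      \<open>green\<close> is exactly what makes the slope vanish at 1.\<close>
    show "?w 1 1 = 0" using a by (simp add: green_def field_simps)
    show "(?w 1 has_real_derivative ?w 2 x) (at x within {0..1})" for x
      using D[of 1 x] by (simp only: one_less_numeral_iff semiring_norm Suc_1)
  qed simp
  have lim0: "uniform_limit {0..1} \<psi> (?w 0) at_top"
  proof (rule uniform_limit_antiderivative[OF _ _ _ _ lim1, where c = 0])
    show "\<forall>\<^sub>F m in at_top. \<psi> m 0 = 0 \<and> (\<forall>x\<in>{0..1}. (\<psi> m has_real_derivative \<psi>' m x) (at x within {0..1}))"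
      using pos
    proof eventually_elim
      case (elim m)
      then show ?case using \<psi>' by blast
    qed
    show "?w 0 0 = 0" using a by (simp add: green_def)
    show "(?w 0 has_real_derivative ?w 1 x) (at x within {0..1})" for x
      using D[of 0 x] by simp
  qed simp
  have w_eq: "w x = ?w 0 x" if "x \<in> {0..1}" for x
    by (rule pointwise_steady_state_eq[OF a w that])
  have "(w has_real_derivative ?w 1 x) (at x within {0..1})" if "x \<in> {0..1}" for x
  proof -
    have "\<forall>\<^sub>F y in nhds x. y \<in> {0..1} \<longrightarrow> w y = ?w 0 y"
      using w_eq by (intro always_eventually) blast
    from has_field_derivative_cong_ev[OF refl this refl refl that] show ?thesis
      using D[of 0 x] by simp
  qed
  moreover have "uniform_limit {0..1} \<psi> w at_top"
    using lim0 w_eq unfolding uniform_limit_iff by simp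
  moreover have "continuous_on {0..1} (?w 1)"
    by (intro continuous_intros green_continuous_on)
  moreover have "\<forall>\<^sub>F m in at_top. continuous_on {0..1} (\<psi>' m) \<and>
      (\<forall>x\<in>{0..1}. (\<psi> m has_real_derivative \<psi>' m x) (at x within {0..1}))"
    using pos
  proof eventually_elim
    case (elim m)
    have "continuous_on {0..1} (\<psi>' m)"
      by (rule DERIV_continuous_on[OF \<psi>'(4)[OF elim]])
    then show ?case using \<psi>'(3)[OF elim] by blast
  qed
  ultimately show ?thesis
    unfolding C1_convergence_def
    by (intro exI[of _ \<psi>'] exI[of _ "?w 1"] conjI ballI lim1)
qed

theorem theorem2:
  fixes N :: nat
    and x :: "nat \<Rightarrow> real"
    and \<alpha> g :: "nat \<Rightarrow> real \<Rightarrow> real"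
    and \<alpha>bar gbar :: "nat \<Rightarrow> real"
    and H \<psi> :: "nat \<Rightarrow> real \<Rightarrow> real \<Rightarrow> real"
    and w :: "nat \<Rightarrow> real \<Rightarrow> real"
  assumes x_bounds: "\<And>j. j \<in> {1..N} \<Longrightarrow> 0 < x j \<and> x j < 1"
    and x_mono: "strict_mono_on {1..N} x"
    and g_C3: "\<And>j. j \<in> {1..N} \<Longrightarrow> C_on 3 {0..} (g j)"
    and g_0: "\<And>j. j \<in> {1..N} \<Longrightarrow> g j 0 = 0"
    and g'_0: "\<And>j. j \<in> {1..N} \<Longrightarrow> (g j has_real_derivative 0) (at 0 within {0..})"
    and \<alpha>_eq: "\<And>j t. j \<in> {1..N} \<Longrightarrow> t \<ge> 0 \<Longrightarrow> \<alpha> j t = - g j t"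
    and \<alpha>bar_eq: "\<And>j. j \<in> {1..N} \<Longrightarrow> \<alpha>bar j = - gbar j"
    and \<alpha>_lim: "\<And>j. j \<in> {1..N} \<Longrightarrow> (\<alpha> j \<longlongrightarrow> \<alpha>bar j) at_top"
    and H: "\<And>j m. j \<in> {1..N} \<Longrightarrow> m > 0 \<Longrightarrow> lifting_function m (x j) (H j m)"
    and w: "\<And>j. j \<in> {1..N} \<Longrightarrow> pointwise_steady_state (x j) (\<alpha>bar j) (w j)"
    and \<psi>: "\<And>j m. j \<in> {1..N} \<Longrightarrow> m > 0 \<Longrightarrow>
           regularized_steady_state (H j m) (gbar j) (\<psi> j m)"
  shows "\<forall>j\<in>{1..N}. C1_convergence {0..1} (\<psi> j) (w j) at_top"
proof
  fix j assume j: "j \<in> {1..N}"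
  show "C1_convergence {0..1} (\<psi> j) (w j) at_top"
  \<comment> \<open>Each input is treated alone, with load \<open>- gbar j\<close>, which is
    \<open>\<alpha>bar j\<close>.\<close>
  proof (rule regularized_steady_state_convergence[of "x j" "H j" "gbar j"])
    show "pointwise_steady_state (x j) (- gbar j) (w j)" using w[OF j] \<alpha>bar_eq[OF j] by simp
  qed (use x_bounds[OF j] H[OF j] \<psi>[OF j] in blast)+
qed

end
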